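(* For any $D>2$ there exist constants $\alpha,m,M,v>0$ (not depending on $n$) such that for all $j\in\{1,2\}$ and all large enough $n$, $$\inf_{\widehat d}\ \sup_{(\Omega,\mu,W)\in\mathcal{W}_n^{min(j)}(D,\alpha,m,M,v)}\ \mathbb{P}_{(\Omega,\mu,W)}\left[\,|\widehat d-\dim\Omega|\ge\frac{D}{2}\right]\ge\frac14,$$ where the infimum is over all estimators $\widehat d$, i.e. all real-valued functions of the adjacency matrix $A\in\{0,1\}^{n\times n}$.
   Context: A graphon is a triplet $(\Omega,\mu,W)$ where $\Omega$ is a measurable space, $\mu$ a probability measure on $\Omega$ and $W:\Omega\times\Omega\to[0,1]$ a symmetric measurable function. Neighborhood distance: $r_W(\omega,\omega')=\big(\int_\Omega |W(\omega,z)-W(\omega',z)|^2\mu(dz)\big)^{1/2}$. A graphon is pure if $(\Omega,r_W)$ is a complete separable metric space and $\mu$ has full support (every ball of non-zero radius has positive measure). $B(\omega,\epsilon)$ is the $r_W$-ball with center $\omega$ and radius $\epsilon$. $N^{(c)}_\Omega(\epsilon)$ is the minimal number of closed $r_W$-balls of radius $\epsilon$ with centers in $\Omega$ needed to cover $\Omega$. The Minkowski dimension is $\dim\Omega=\lim_{\epsilon\to0}\frac{\log N^{(c)}_\Omega(\epsilon)}{-\log\epsilon}$ when the limit exists. Consider, for a pure graphon with existing dimension $d:=\dim\Omega\le D$, the conditions: $(H_1)$ $\alpha\epsilon^d\le\mu[B(\omega,\epsilon)]$ for all $\omega\in\Omega$ and all $\epsilon\in(1/n,v]$; $(H_2)$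 $m\epsilon^{-d}\le N^{(c)}_\Omega(\epsilon)\le M\epsilon^{-d}$ for all $\epsilon\in(1/n,v]$ (with $M\ge1\ge m>0$). $\mathcal{W}_n^{min(1)}(D,\alpha,m,M,v)$ is the set of all pure graphons with $\dim\Omega\le D$ satisfying $(H_2)$ (the condition $(H_1)$ being dropped), and $\mathcal{W}_n^{min(2)}(D,\alpha,m,M,v)$ is the set of all pure graphons with $\dim\Omega\le D$ satisfying $(H_1)$ (the condition $(H_2)$ being dropped). $W$-random graph model on $n$ nodes: $\omega_1,\dots,\omega_n$ are i.i.d. with law $\mu$ (unobserved); conditionally on them, the entries $A_{ij}$, $i<j$, are independent Bernoulli with parameters $W(\omega_i,\omega_j)$; $A_{ji}=A_{ij}$, $A_{ii}=0$. $\mathbb{P}_{(\Omega,\mu,W)}$ denotes the corresponding probability. *)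

theory Defs
  imports "HOL-Probability.Probability"
begin

text \<open>
  The measurable space \<open>\<Omega>\<close> is carried by the measure: it is \<open>space \<mu>\<close> with the
  sigma-algebra \<open>sets \<mu>\<close>. Only the values of \<open>W\<close> on \<open>space \<mu> \<times> space \<mu>\<close> matter.
\<close>

type_synonym 'a graphon = "'a measure \<times> ('a \<Rightarrow> 'a \<Rightarrow> real)"

definition graphon :: "'a measure \<Rightarrow> ('a \<Rightarrow> 'a \<Rightarrow> real) \<Rightarrow> bool" where
  "graphon \<mu> W \<longleftrightarrow>
     prob_space \<mu> \<and>
     (\<lambda>(x, y). W x y) \<in> borel_measurable (\<mu> \<Otimes>\<^sub>M \<mu>) \<and>
     (\<forall>x\<in>space \<mu>. \<forall>y\<in>space \<mu>. 0 \<le> W x y \<and> W x y \<le> 1 \<and> W x y = W y x)"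

definition nbhd_dist :: "'a measure \<Rightarrow> ('a \<Rightarrow> 'a \<Rightarrow> real) \<Rightarrow> 'a \<Rightarrow> 'a \<Rightarrow> real" where
  "nbhd_dist \<mu> W x y = sqrt (\<integral>z. \<bar>W x z - W y z\<bar>\<^sup>2 \<partial>\<mu>)"

abbreviation graphon_ball :: "'a measure \<Rightarrow> ('a \<Rightarrow> 'a \<Rightarrow> real) \<Rightarrow> 'a \<Rightarrow> real \<Rightarrow> 'a set" where
  "graphon_ball \<mu> W \<equiv> Metric_space.mball (space \<mu>) (nbhd_dist \<mu> W)"

abbreviation graphon_cball :: "'a measure \<Rightarrow> ('a \<Rightarrow> 'a \<Rightarrow> real) \<Rightarrow> 'a \<Rightarrow> real \<Rightarrow> 'a set" where
  "graphon_cball \<mu> W \<equiv> Metric_space.mcball (space \<mu>) (nbhd_dist \<mu> W)"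

text \<open>
  \<open>Metric_space\<close> includes that distinct points of \<open>\<Omega>\<close> are at positive distance.
\<close>

definition pure_graphon :: "'a measure \<Rightarrow> ('a \<Rightarrow> 'a \<Rightarrow> real) \<Rightarrow> bool" where
  "pure_graphon \<mu> W \<longleftrightarrow>
     graphon \<mu> W \<and>
     Metric_space (space \<mu>) (nbhd_dist \<mu> W) \<and>
     Metric_space.mcomplete (space \<mu>) (nbhd_dist \<mu> W) \<and>
     separable_space (Metric_space.mtopology (space \<mu>) (nbhd_dist \<mu> W)) \<and>
     (\<forall>x\<in>space \<mu>. \<forall>\<epsilon>>0. emeasure \<mu> (graphon_ball \<mu> W x \<epsilon>) > 0)"

text \<open>The covering number is \<open>\<infinity>\<close> if no finite cover exists (infimum of the empty set).\<close>

definition covering_number :: "'a measure \<Rightarrow> ('a \<Rightarrow> 'a \<Rightarrow> real) \<Rightarrow> real \<Rightarrow> enat" where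
  "covering_number \<mu> W \<epsilon> =
     (INF C\<in>{C. finite C \<and> C \<subseteq> space \<mu> \<and> space \<mu> \<subseteq> (\<Union>c\<in>C. graphon_cball \<mu> W c \<epsilon>)}.
        enat (card C))"

definition ln_enat :: "enat \<Rightarrow> ereal" where
  "ln_enat N = (case N of enat k \<Rightarrow> ereal (ln (real k)) | \<infinity> \<Rightarrow> \<infinity>)"

definition has_minkowski_dim :: "'a measure \<Rightarrow> ('a \<Rightarrow> 'a \<Rightarrow> real) \<Rightarrow> real \<Rightarrow> bool" where
  "has_minkowski_dim \<mu> W d \<longleftrightarrow>
     ((\<lambda>\<epsilon>. ln_enat (covering_number \<mu> W \<epsilon>) / ereal (- ln \<epsilon>)) \<longlongrightarrow> ereal d) (at_right 0)"

definition minkowski_dim :: "'a measure \<Rightarrow> ('a \<Rightarrow> 'a \<Rightarrow> real) \<Rightarrow> real" where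
  "minkowski_dim \<mu> W = (THE d. has_minkowski_dim \<mu> W d)"

lemma minkowski_dim_eqI:
  assumes "has_minkowski_dim \<mu> W d"
  shows "minkowski_dim \<mu> W = d"
  unfolding minkowski_dim_def
proof (rule the_equality)
  show "has_minkowski_dim \<mu> W d" by (rule assms)
next
  fix d' assume "has_minkowski_dim \<mu> W d'"
  then have "ereal d' = ereal d"
    using assms unfolding has_minkowski_dim_def
    by (intro tendsto_unique[OF trivial_limit_at_right_real])
  then show "d' = d" by simp
qed

definition mass_condition ::
    "nat \<Rightarrow> real \<Rightarrow> real \<Rightarrow> 'a measure \<Rightarrow> ('a \<Rightarrow> 'a \<Rightarrow> real) \<Rightarrow> bool" where
  "mass_condition n \<alpha> v \<mu> W \<longleftrightarrow>
     (\<forall>x\<in>space \<mu>. \<forall>\<epsilon>\<in>{1 / real n<..v}.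
        \<alpha> * \<epsilon> powr minkowski_dim \<mu> W \<le> measure \<mu> (graphon_ball \<mu> W x \<epsilon>))"

definition covering_condition ::
    "nat \<Rightarrow> real \<Rightarrow> real \<Rightarrow> real \<Rightarrow> 'a measure \<Rightarrow> ('a \<Rightarrow> 'a \<Rightarrow> real) \<Rightarrow> bool" where
  "covering_condition n m M v \<mu> W \<longleftrightarrow>
     (\<forall>\<epsilon>\<in>{1 / real n<..v}.
        ereal (m * \<epsilon> powr (- minkowski_dim \<mu> W)) \<le> ereal_of_enat (covering_number \<mu> W \<epsilon>) \<and>
        ereal_of_enat (covering_number \<mu> W \<epsilon>) \<le> ereal (M * \<epsilon> powr (- minkowski_dim \<mu> W)))"

text \<open>
  HOL cannot quantify over types inside a formula, so a set of graphons has a fixed carrier type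
  \<open>'a\<close> (with \<open>space \<mu>\<close> an arbitrary subset of it). For \<open>'a = real\<close> nothing is lost: a
  pure graphon is a separable metric space, hence has at most continuum many points, and is
  isomorphic, by transport along an injection, to one whose points are real numbers.
\<close>

definition W_min1 ::
    "nat \<Rightarrow> real \<Rightarrow> real \<Rightarrow> real \<Rightarrow> real \<Rightarrow> real \<Rightarrow> 'a graphon set" where
  "W_min1 n D \<alpha> m M v =
     {(\<mu>, W). pure_graphon \<mu> W \<and> (\<exists>d. has_minkowski_dim \<mu> W d) \<and> minkowski_dim \<mu> W \<le> D \<and>
        covering_condition n m M v \<mu> W}"

definition W_min2 ::
    "nat \<Rightarrow> real \<Rightarrow> real \<Rightarrow> real \<Rightarrow> real \<Rightarrow> real \<Rightarrow> 'a graphon set" where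
  "W_min2 n D \<alpha> m M v =
     {(\<mu>, W). pure_graphon \<mu> W \<and> (\<exists>d. has_minkowski_dim \<mu> W d) \<and> minkowski_dim \<mu> W \<le> D \<and>
        mass_condition n \<alpha> v \<mu> W}"

text \<open>
  An \<open>n \<times> n\<close> adjacency matrix is a function on \<open>nat \<times> nat\<close> that vanishes outside the index
  range. A family \<open>u\<close> of edge indicators is read at pairs \<open>(i, j)\<close> with \<open>i < j\<close>; the
  default value \<open>False\<close> of \<open>Pi_pmf\<close> yields the zero diagonal and the zeros outside the range.
\<close>

type_synonym adj_matrix = "nat \<Rightarrow> nat \<Rightarrow> nat"

definition adj_matrix_of :: "(nat \<times> nat \<Rightarrow> bool) \<Rightarrow> adj_matrix" where
  "adj_matrix_of u = (\<lambda>i j. of_bool (u (min i j, max i j)))"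

definition cond_adj_pmf ::
    "nat \<Rightarrow> ('a \<Rightarrow> 'a \<Rightarrow> real) \<Rightarrow> (nat \<Rightarrow> 'a) \<Rightarrow> adj_matrix pmf" where
  "cond_adj_pmf n W \<omega> =
     map_pmf adj_matrix_of
       (Pi_pmf {(i, j). i < j \<and> j < n} False (\<lambda>(i, j). bernoulli_pmf (W (\<omega> i) (\<omega> j))))"

definition W_random_graph ::
    "nat \<Rightarrow> 'a measure \<Rightarrow> ('a \<Rightarrow> 'a \<Rightarrow> real) \<Rightarrow> adj_matrix measure" where
  "W_random_graph n \<mu> W =
     Giry_Monad.bind (Pi\<^sub>M {..<n} (\<lambda>_. \<mu>)) (\<lambda>\<omega>. measure_pmf (cond_adj_pmf n W \<omega>))"

text \<open>
  The kernel in this definition is measurable, so the law is a probability measure on all sets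
  of matrices, and probabilities are averages of the conditional ones.
\<close>

lemma measurable_cond_adj_pmf:
  assumes "graphon \<mu> W"
  shows "(\<lambda>\<omega>. measure_pmf (cond_adj_pmf n W \<omega>))
           \<in> Pi\<^sub>M {..<n} (\<lambda>_. \<mu>) \<rightarrow>\<^sub>M prob_algebra (count_space UNIV)"
proof (rule measurable_prob_algebraI)
  let ?P = "Pi\<^sub>M {..<n} (\<lambda>_. \<mu>)"
  define E where "E = {(i, j). i < j \<and> j < n}"
  define S where "S = {u :: nat \<times> nat \<Rightarrow> bool. \<forall>e. e \<notin> E \<longrightarrow> u e = False}"
  have "E \<subseteq> {..<n} \<times> {..<n}" by (auto simp: E_def)
  then have fin_E: "finite E" by (rule finite_subset) simp
  have fin_S: "finite S"
  proof (rule finite_subset)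
    show "S \<subseteq> (\<lambda>B e. e \<in> B) ` Pow E"
    proof
      fix u assume "u \<in> S"
      then have "u = (\<lambda>e. e \<in> {e. u e})" "{e. u e} \<in> Pow E" by (auto simp: S_def)
      then show "u \<in> (\<lambda>B e. e \<in> B) ` Pow E" by (rule image_eqI)
    qed
  qed (simp add: fin_E)
  show "prob_space (measure_pmf (cond_adj_pmf n W \<omega>))" for \<omega>
    by (rule measure_pmf.prob_space_axioms)
  show "(\<lambda>\<omega>. measure_pmf (cond_adj_pmf n W \<omega>)) \<in> ?P \<rightarrow>\<^sub>M subprob_algebra (count_space UNIV)"
  proof (rule measurable_subprob_algebra)
    fix X :: "adj_matrix set"
    define B where "B = adj_matrix_of -` X \<inter> S"
    have W_meas: "(\<lambda>\<omega>. W (\<omega> i) (\<omega> j)) \<in> borel_measurable ?P" if "i < n" "j < n" for i j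
    proof -
      have "(\<lambda>\<omega>. (\<omega> i, \<omega> j)) \<in> ?P \<rightarrow>\<^sub>M \<mu> \<Otimes>\<^sub>M \<mu>"
        using that by (intro measurable_Pair measurable_component_singleton) auto
      moreover have "(\<lambda>(x, y). W x y) \<in> borel_measurable (\<mu> \<Otimes>\<^sub>M \<mu>)"
        using assms unfolding graphon_def by blast
      ultimately have "(\<lambda>\<omega>. (\<lambda>(x, y). W x y) (\<omega> i, \<omega> j)) \<in> borel_measurable ?P"
        by (rule measurable_compose)
      then show ?thesis by simp
    qed
    have eq: "emeasure (measure_pmf (cond_adj_pmf n W \<omega>)) X =
        ennreal (\<Sum>u\<in>B. \<Prod>(i, j)\<in>E. if u (i, j) then W (\<omega> i) (\<omega> j) else 1 - W (\<omega> i) (\<omega> j))"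
      if \<omega>: "\<omega> \<in> space ?P" for \<omega>
    proof -
      let ?Q = "Pi_pmf E False (\<lambda>(i, j). bernoulli_pmf (W (\<omega> i) (\<omega> j)))"
      have \<omega>_in: "\<omega> i \<in> space \<mu>" if "i < n" for i
        using \<omega> that by (auto simp: space_PiM)
      have W_range: "0 \<le> W x y \<and> W x y \<le> 1" if "x \<in> space \<mu>" "y \<in> space \<mu>" for x y
        using assms that unfolding graphon_def by blast
      have W01: "0 \<le> W (\<omega> i) (\<omega> j) \<and> W (\<omega> i) (\<omega> j) \<le> 1" if e: "(i, j) \<in> E" for i j
      proof -
        have "i < n" "j < n" using e by (auto simp: E_def)
        then show ?thesis by (intro W_range \<omega>_in)
      qed
      have "emeasure (measure_pmf (cond_adj_pmf n W \<omega>)) X = emeasure ?Q (adj_matrix_of -` X)"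
        by (simp add: cond_adj_pmf_def E_def)
      also have "\<dots> = emeasure ?Q (adj_matrix_of -` X \<inter> set_pmf ?Q)"
        by (rule emeasure_Int_set_pmf[symmetric])
      also have "\<dots> = emeasure ?Q (B \<inter> set_pmf ?Q)"
        using set_Pi_pmf_subset[OF fin_E, of False] unfolding B_def S_def
        by (intro arg_cong2[where f = emeasure] refl) blast
      also have "\<dots> = emeasure ?Q B" by (rule emeasure_Int_set_pmf)
      also have "\<dots> = ennreal (\<Sum>u\<in>B. pmf ?Q u)"
        using fin_S by (simp add: B_def emeasure_measure_pmf_finite)
      also have "(\<Sum>u\<in>B. pmf ?Q u) =
          (\<Sum>u\<in>B. \<Prod>(i, j)\<in>E. if u (i, j) then W (\<omega> i) (\<omega> j) else 1 - W (\<omega> i) (\<omega> j))"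
      proof (rule sum.cong[OF refl])
        fix u assume "u \<in> B"
        then have "\<And>e. e \<notin> E \<Longrightarrow> u e = False"
          unfolding B_def S_def by blast
        then have "pmf ?Q u = (\<Prod>e\<in>E. pmf (case e of (i, j) \<Rightarrow> bernoulli_pmf (W (\<omega> i) (\<omega> j))) (u e))"
          by (rule pmf_Pi'[OF fin_E])
        also have "\<dots> = (\<Prod>(i, j)\<in>E. if u (i, j) then W (\<omega> i) (\<omega> j) else 1 - W (\<omega> i) (\<omega> j))"
          using W01 by (intro prod.cong refl) (auto split: prod.splits)
        finally show "pmf ?Q u = \<dots>" .
      qed
      finally show ?thesis .
    qed
    have "(\<lambda>\<omega>. ennreal (\<Sum>u\<in>B. \<Prod>(i, j)\<in>E. if u (i, j) then W (\<omega> i) (\<omega> j) else 1 - W (\<omega> i) (\<omega> j)))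
        \<in> borel_measurable ?P"
    proof (intro measurable_compose[OF _ measurable_ennreal] borel_measurable_sum borel_measurable_prod)
      fix u e assume "e \<in> E"
      then obtain i j where "e = (i, j)" "i < n" "j < n" by (auto simp: E_def)
      then show "(\<lambda>\<omega>. case e of (i, j) \<Rightarrow> if u (i, j) then W (\<omega> i) (\<omega> j) else 1 - W (\<omega> i) (\<omega> j))
          \<in> borel_measurable ?P"
        using W_meas[of i j] by (cases "u e") (auto intro!: borel_measurable_diff)
    qed
    then show "(\<lambda>\<omega>. emeasure (measure_pmf (cond_adj_pmf n W \<omega>)) X) \<in> borel_measurable ?P"
      by (simp only: measurable_cong[OF eq])
  qed (auto intro: prob_space_imp_subprob_space measure_pmf.prob_space_axioms)
qed

lemma
  assumes "graphon \<mu> W"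
  shows prob_space_W_random_graph: "prob_space (W_random_graph n \<mu> W)"
    and sets_W_random_graph: "sets (W_random_graph n \<mu> W) = UNIV"
    and emeasure_W_random_graph:
      "emeasure (W_random_graph n \<mu> W) X =
         (\<integral>\<^sup>+\<omega>. emeasure (measure_pmf (cond_adj_pmf n W \<omega>)) X \<partial>Pi\<^sub>M {..<n} (\<lambda>_. \<mu>))"
proof -
  let ?P = "Pi\<^sub>M {..<n} (\<lambda>_. \<mu>)"
  have "prob_space \<mu>" using assms by (simp add: graphon_def)
  then have "prob_space ?P" by (intro prob_space_PiM)
  then have P: "?P \<in> space (prob_algebra ?P)" by (simp add: space_prob_algebra)
  note K = measurable_cond_adj_pmf[OF assms, of n]
  show "emeasure (W_random_graph n \<mu> W) X =
      (\<integral>\<^sup>+\<omega>. emeasure (measure_pmf (cond_adj_pmf n W \<omega>)) X \<partial>?P)"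
    unfolding W_random_graph_def by (rule emeasure_bind_prob_algebra[OF P K]) simp
  have "W_random_graph n \<mu> W \<in> space (prob_algebra (count_space UNIV))"
    unfolding W_random_graph_def
    using P K by (simp add: space_prob_algebra prob_space_bind' sets_bind')
  then show "prob_space (W_random_graph n \<mu> W)" "sets (W_random_graph n \<mu> W) = UNIV"
    by (simp_all add: space_prob_algebra)
qed

end

theory Submission
  imports Defs
begin

text \<open>
  Two graphons of dimensions \<open>0\<close> and \<open>D\<close> are compared that both produce the empty graph with
  probability at least \<open>1 / 2\<close>; whatever value the estimator takes on the empty graph, it is off by
  \<open>D / 2\<close> for one of them. The first is the one-point graphon with \<open>W = 0\<close>. The second is a countable
  bipartite graphon. The rows of the vertices on its rare side, of total mass \<open>\<delta> = 1 / (2 n)\<close>, form at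
  each level \<open>j\<close> a family of \<open>2 ^ j\<close> Walsh functions, supported on a part of mass of order
  \<open>2 powr (- 2 j / D)\<close> of the frequent side, so their mutual distances are of order \<open>2 powr (- j / D)\<close>
  and the covering numbers are of order \<open>\<epsilon> powr - D\<close> with constants independent of \<open>\<delta>\<close>. Yet with
  probability at least \<open>1 - n \<delta>\<close> no rare vertex is sampled, and the graph is empty. If \<open>W\<close> is
  multiplied by \<open>1 / (2 n)\<close>, the dimension is unchanged but the diameter drops below \<open>1 / n\<close>, and the
  mass condition becomes trivial on the scales where it is required.
\<close>

section \<open>Scales, completeness and empty graphs\<close>

text \<open>Since \<open>2 powr (- 1 / D)\<close> to the power \<open>- D\<close> is 2, one integer,
  the floor of \<open>- D * log 2 t\<close>, locates \<open>t\<close> among the powers of this ratio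
  and \<open>t powr - D\<close> among the powers of 2. It selects the level that matches a covering
  radius.\<close>

lemma dyadic_scale:
  fixes D t :: real
  assumes "D > 0" "0 < t" "t < 1"
  obtains J where "(2 powr (- 1 / D)) ^ Suc J < t" "t \<le> (2 powr (- 1 / D)) ^ J"
    "2 ^ J \<le> t powr - D" "t powr - D \<le> 2 ^ Suc J"
proof -
  define L where "L = - D * log 2 t"
  have "log 2 t < 0" using assms by simp
  then have "L > 0" using assms by (simp add: L_def mult_pos_neg)
  define J where "J = nat \<lfloor>L\<rfloor>"
  have J: "real J \<le> L" "L < real (Suc J)"
    using \<open>L > 0\<close> unfolding J_def by linarith+
  have JD: "real J / D \<le> L / D" "L / D < real (Suc J) / D"
    using J assms by (auto intro: divide_right_mono divide_strict_right_mono simp del: of_nat_Suc)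
  have log_t: "log 2 t = - L / D" using assms by (simp add: L_def)
  have "t = 2 powr (log 2 t)" using assms by simp
  then have t: "t = 2 powr (- L / D)" by (simp only: log_t)
  have t': "t powr - D = 2 powr L"
    using assms by (simp add: t powr_powr)
  have pow: "(2 powr (- 1 / D)) ^ k = 2 powr (- real k / D)" for k
    by (simp add: powr_powr flip: powr_realpow)
  have pow': "(2::real) ^ k = 2 powr real k" for k
    by (simp add: powr_realpow)
  show thesis
  proof (rule that[of J])
    show "(2 powr (- 1 / D)) ^ Suc J < t" "t \<le> (2 powr (- 1 / D)) ^ J"
      using JD unfolding pow t by (simp_all del: of_nat_Suc)
    show "2 ^ J \<le> t powr - D" "t powr - D \<le> 2 ^ Suc J"
      using J unfolding pow' t' by (auto intro: powr_mono)
  qed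
qed

text \<open>A Cauchy sequence that does not converge to \<open>p\<close> is infinitely often at
  least some fixed \<open>\<epsilon>\<close> away from \<open>p\<close>; isolation with a uniform
  radius then makes it eventually constant.\<close>

lemma (in Metric_space) mcomplete_if_isolated_away_from_point:
  assumes p: "p \<in> M"
    and isolated: "\<And>\<epsilon>. \<epsilon> > 0 \<Longrightarrow>
      \<exists>\<eta>>0. \<forall>x\<in>M. \<forall>y\<in>M. \<epsilon> \<le> d x p \<longrightarrow> d x y < \<eta> \<longrightarrow> y = x"
  shows mcomplete
  unfolding mcomplete_def
proof (intro allI impI)
  fix \<sigma> assume \<sigma>: "MCauchy \<sigma>"
  then have M: "\<sigma> n \<in> M" for n by (auto simp: MCauchy_def)
  show "\<exists>x. limitin mtopology \<sigma> x sequentially"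
  proof (cases "limitin mtopology \<sigma> p sequentially")
    case False
    then obtain \<epsilon> where "\<epsilon> > 0" and \<epsilon>: "\<And>N. \<exists>n\<ge>N. \<epsilon> \<le> d (\<sigma> n) p"
      using M p unfolding limit_metric_sequentially by (meson not_le)
    obtain \<eta> where "\<eta> > 0"
      and \<eta>: "\<forall>x\<in>M. \<forall>y\<in>M. \<epsilon> \<le> d x p \<longrightarrow> d x y < \<eta> \<longrightarrow> y = x"
      using isolated[OF \<open>\<epsilon> > 0\<close>] by blast
    obtain N where N: "\<And>n n'. N \<le> n \<Longrightarrow> N \<le> n' \<Longrightarrow> d (\<sigma> n) (\<sigma> n') < \<eta>"
      using \<sigma> \<open>\<eta> > 0\<close> unfolding MCauchy_def by blast
    obtain n where "n \<ge> N" "\<epsilon> \<le> d (\<sigma> n) p" using \<epsilon> by blast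
    then have "\<sigma> n' = \<sigma> n" if "n' \<ge> N" for n'
      using that N[of n n'] \<eta> M by blast
    then have "limitin mtopology \<sigma> (\<sigma> n) sequentially"
      unfolding limit_metric_sequentially using M by (metis zero)
    then show ?thesis by blast
  qed blast
qed

text \<open>With probability \<open>emeasure \<mu> G ^ n\<close> all sampled points lie in
  \<open>G\<close>; then every edge probability is 0 and the graph is empty.\<close>

lemma power_le_emeasure_W_random_graph_zero:
  assumes "graphon \<mu> W" and G: "G \<in> sets \<mu>"
    and zero: "\<And>x y. x \<in> G \<Longrightarrow> y \<in> G \<Longrightarrow> W x y = 0"
  shows "emeasure \<mu> G ^ n \<le> emeasure (W_random_graph n \<mu> W) {\<lambda>i j. 0}"
proof -
  interpret prob_space \<mu> using assms by (simp add: graphon_def)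
  interpret P: product_sigma_finite "\<lambda>_::nat. \<mu>"
    by unfold_locales
  let ?P = "Pi\<^sub>M {..<n} (\<lambda>_. \<mu>)" and ?B = "Pi\<^sub>E {..<n} (\<lambda>_. G)"
  have B: "?B \<in> sets ?P" using G by (intro sets_PiM_I_finite) auto
  have cond: "cond_adj_pmf n W \<omega> = return_pmf (\<lambda>i j. 0)" if "\<omega> \<in> ?B" for \<omega>
  proof -
    have "Pi_pmf {(i, j). i < j \<and> j < n} False (\<lambda>(i, j). bernoulli_pmf (W (\<omega> i) (\<omega> j)))
      = Pi_pmf {(i, j). i < j \<and> j < n} False (\<lambda>_. return_pmf False)"
    proof (rule Pi_pmf_cong)
      fix e assume "e \<in> {(i, j). i < j \<and> j < n}"
      then obtain i j where e: "e = (i, j)" "i < n" "j < n" by auto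
      then have "W (\<omega> i) (\<omega> j) = 0" using that by (intro zero) auto
      then show "(case e of (i, j) \<Rightarrow> bernoulli_pmf (W (\<omega> i) (\<omega> j))) = return_pmf False"
        by (auto simp: e intro!: pmf_eqI split: split_indicator)
    qed auto
    also have "\<dots> = return_pmf (\<lambda>_. False)"
    proof -
      have "finite {(i, j). i < j \<and> j < n}"
        by (rule finite_subset[of _ "{..<n} \<times> {..<n}"]) auto
      then show ?thesis by simp
    qed
    finally show ?thesis
      by (simp add: cond_adj_pmf_def adj_matrix_of_def)
  qed
  have "emeasure \<mu> G ^ n = (\<integral>\<^sup>+\<omega>. indicator ?B \<omega> \<partial>?P)"
    using B G by (simp add: P.emeasure_PiM)
  also have "\<dots> \<le> (\<integral>\<^sup>+\<omega>. emeasure (measure_pmf (cond_adj_pmf n W \<omega>)) {\<lambda>i j. 0} \<partial>?P)"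
    by (intro nn_integral_mono) (auto simp: cond split: split_indicator)
  also have "\<dots> = emeasure (W_random_graph n \<mu> W) {\<lambda>i j. 0}"
    by (rule emeasure_W_random_graph[OF assms(1), symmetric])
  finally show ?thesis .
qed

subsection \<open>Discrete graphons\<close>

text \<open>The graphon classes in the theorem have carrier type \<open>real\<close>, so countable
  models are moved there along an injection.\<close>

definition encode :: "'c :: countable \<Rightarrow> real" where
  "encode u = real (to_nat u)"

definition decode :: "real \<Rightarrow> 'c :: countable" where
  "decode = inv encode"

lemma inj_encode: "inj encode"
  by (auto simp: inj_def encode_def)

lemma encode_eq_iff [simp]: "encode u = encode v \<longleftrightarrow> u = v"
  using inj_encode by (auto simp: inj_def)

lemma decode_encode [simp]: "decode (encode u) = u"
  by (simp add: decode_def inj_encode)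

text \<open>The space is only the range of \<open>encode\<close>: any other real would be at
  distance 0 from the code of its decoded value, against the metric axioms.\<close>

definition encoded_measure :: "'c :: countable pmf \<Rightarrow> real measure" where
  "encoded_measure p = distr (measure_pmf p) (count_space (range (encode :: 'c \<Rightarrow> real))) encode"

definition encoded_kernel :: "('c :: countable \<Rightarrow> 'c \<Rightarrow> real) \<Rightarrow> real \<Rightarrow> real \<Rightarrow> real" where
  "encoded_kernel w x y = w (decode x) (decode y)"

lemma encoded_kernel_encode [simp]: "encoded_kernel w (encode u) (encode v) = w u v"
  by (simp add: encoded_kernel_def)

lemma space_encoded_measure [simp]:
  fixes p :: "'c :: countable pmf"
  shows "space (encoded_measure p) = range (encode :: 'c \<Rightarrow> real)"
  by (simp add: encoded_measure_def)

lemma sets_encoded_measure [simp]: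
  fixes p :: "'c :: countable pmf"
  shows "sets (encoded_measure p) = Pow (range (encode :: 'c \<Rightarrow> real))"
  by (simp add: encoded_measure_def)

lemma emeasure_encoded_measure:
  "emeasure (encoded_measure p) (encode ` S) = emeasure (measure_pmf p) S"
proof -
  have "encode -` encode ` S = S" by (rule inj_vimage_image_eq[OF inj_encode])
  then show ?thesis
    unfolding encoded_measure_def by (subst emeasure_distr) auto
qed

lemma prob_space_encoded_measure: "prob_space (encoded_measure p)"
  unfolding encoded_measure_def by (intro prob_space.prob_space_distr measure_pmf.prob_space_axioms) simp

text \<open>The product of two countable discrete spaces is discrete, so measurability of the kernel
  is automatic.\<close>

lemma graphon_encoded:
  fixes p :: "'c :: countable pmf" and w :: "'c \<Rightarrow> 'c \<Rightarrow> real"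
  assumes "\<And>u v. 0 \<le> w u v" "\<And>u v. w u v \<le> 1" "\<And>u v. w u v = w v u"
  shows "graphon (encoded_measure p) (encoded_kernel w)"
proof -
  let ?C = "count_space (range (encode :: 'c \<Rightarrow> real))"
  have "sets (encoded_measure p \<Otimes>\<^sub>M encoded_measure p) = sets (?C \<Otimes>\<^sub>M ?C)"
    by (intro sets_pair_measure_cong) (auto simp: encoded_measure_def)
  also have "?C \<Otimes>\<^sub>M ?C = count_space (range (encode :: 'c \<Rightarrow> real) \<times> range (encode :: 'c \<Rightarrow> real))"
    by (intro pair_measure_countable) auto
  finally have "(borel_measurable (encoded_measure p \<Otimes>\<^sub>M encoded_measure p) :: (real \<times> real \<Rightarrow> real) set)
      = borel_measurable (count_space (range (encode :: 'c \<Rightarrow> real) \<times> range (encode :: 'c \<Rightarrow> real)))"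
    by (rule measurable_cong_sets) (rule refl)
  then have "(\<lambda>(x, y). encoded_kernel w x y)
      \<in> borel_measurable (encoded_measure p \<Otimes>\<^sub>M encoded_measure p)"
    by (simp only: measurable_count_space_eq1) auto
  then show ?thesis
    using assms by (auto simp: graphon_def prob_space_encoded_measure)
qed

lemma nbhd_dist_encoded:
  fixes p :: "'c :: countable pmf"
  shows "nbhd_dist (encoded_measure p) (encoded_kernel w) (encode u) (encode v)
    = sqrt (\<integral>z. \<bar>w u z - w v z\<bar>\<^sup>2 \<partial>measure_pmf p)"
  unfolding nbhd_dist_def encoded_measure_def by (subst integral_distr) auto

subsection \<open>Walsh graphons\<close>

text \<open>On lists of equal length these are the characters of the group of bit vectors: the sign
  is the parity of the number of positions where both entries are \<open>True\<close>.\<close>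

fun walsh :: "bool list \<Rightarrow> bool list \<Rightarrow> real" where
  "walsh (a # x) (b # y) = (if a \<and> b then - 1 else 1) * walsh x y"
| "walsh _ _ = 1"

lemma walsh_cases: "walsh x y = 1 \<or> walsh x y = - 1"
  by (induction x y rule: walsh.induct) auto

lemma walsh_commute: "walsh x y = walsh y x"
  by (induction x y rule: walsh.induct) auto

lemma finite_bool_lists [simp]: "finite {y :: bool list. length y = n}"
  using finite_lists_length_eq[of "UNIV :: bool set" n] by simp

lemma card_bool_lists [simp]: "card {y :: bool list. length y = n} = 2 ^ n"
  using card_lists_length_eq[of "UNIV :: bool set" n] by simp

text \<open>Orthogonality of characters, by splitting off the first bit: its two sign products
  cancel if the heads differ, and otherwise double the sum over the tails.\<close>

lemma walsh_orthogonal: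
  assumes "length x = n" "length x' = n"
  shows "(\<Sum>y | length y = n. walsh x y * walsh x' y) = (if x = x' then 2 ^ n else 0)"
  using assms
proof (induction n arbitrary: x x')
  case 0
  then show ?case by simp
next
  case (Suc n)
  obtain a z where x: "x = a # z" "length z = n" using Suc.prems(1) by (cases x) auto
  obtain a' z' where x': "x' = a' # z'" "length z' = n" using Suc.prems(2) by (cases x') auto
  have lists: "{y. length y = Suc n} = (\<lambda>(b, y). b # y) ` (UNIV \<times> {y :: bool list. length y = n})"
    by (auto simp: length_Suc_conv)
  have "(\<Sum>y | length y = Suc n. walsh x y * walsh x' y)
      = (\<Sum>(b, y)\<in>UNIV \<times> {y. length y = n}. walsh x (b # y) * walsh x' (b # y))"
    unfolding lists by (subst sum.reindex) (auto simp: inj_on_def case_prod_unfold)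
  also have "\<dots> = (\<Sum>b\<in>UNIV. \<Sum>y | length y = n. walsh x (b # y) * walsh x' (b # y))"
    by (rule sum.cartesian_product[symmetric])
  also have "\<dots> = (if a = a' then 2 else 0) * (\<Sum>y | length y = n. walsh z y * walsh z' y)"
    by (simp add: x x' UNIV_bool sum_negf)
  also have "\<dots> = (if x = x' then 2 ^ Suc n else 0)"
    using Suc.IH[OF x(2) x'(2)] by (simp add: x x')
  finally show ?case .
qed

text \<open>
  The flag distinguishes the two sides of the bipartite graph, and the list lives at the level
  given by its length. \<open>None\<close> is the limit of the levels; it makes the space complete.
\<close>

type_synonym node = "(bool \<times> bool list) option"

text \<open>
  The values are shifted away from \<open>0\<close> so that rows of different levels, which have disjoint
  supports, are also far apart.
\<close>

fun walsh_kernel :: "real \<Rightarrow> node \<Rightarrow> node \<Rightarrow> real" where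
  "walsh_kernel c (Some (s, x)) (Some (t, y)) =
     (if s \<noteq> t \<and> length x = length y then c * (3 + walsh x y) / 4 else 0)"
| "walsh_kernel c _ _ = 0"

lemma walsh_kernel_None [simp]: "walsh_kernel c u None = 0" "walsh_kernel c None u = 0"
  by (cases u; simp)+

lemma walsh_kernel_commute: "walsh_kernel c u v = walsh_kernel c v u"
  by (induction c u v rule: walsh_kernel.induct) (auto simp: walsh_commute)

fun level :: "node \<Rightarrow> nat" where
  "level None = 0"
| "level (Some (s, x)) = length x"

definition nodes :: "nat \<Rightarrow> node set" where
  "nodes J = Some ` (UNIV \<times> {x. length x \<le> J})"

lemma finite_nodes [simp]: "finite (nodes J)"
  using finite_lists_length_le[of "UNIV :: bool set" J] by (simp add: nodes_def)

lemma card_nodes: "card (nodes J) = 2 * (2 ^ Suc J - 1)"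
proof -
  have "card {x :: bool list. length x \<le> J} = (\<Sum>i\<le>J. 2 ^ i)"
    using card_lists_length_le[of "UNIV :: bool set" J] by simp
  also have "\<dots> = 2 ^ Suc J - 1"
    by (induction J) auto
  finally show ?thesis
    by (simp add: nodes_def card_image card_cartesian_product)
qed

text \<open>A row is supported on the level of its node, so integrals of rows of bounded level
  reduce to finite sums over \<open>nodes J\<close>.\<close>

lemma walsh_kernel_eq_0: "level u \<le> J \<Longrightarrow> v \<notin> nodes J \<Longrightarrow> walsh_kernel c u v = 0"
  by (induction c u v rule: walsh_kernel.induct) (auto simp: nodes_def)

section \<open>The law of the nodes and the distances between rows\<close>

locale walsh_graphon =
  fixes D \<delta> c :: real
  assumes D: "D > 0" and \<delta>: "0 < \<delta>" "\<delta> \<le> 1 / 2" and c: "0 < c" "c \<le> 1"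
begin

text \<open>
  The ratio satisfies \<open>\<beta> powr - D = 2\<close>, so that the \<open>2 ^ j\<close> rows of level \<open>j\<close>, at mutual distance
  of order \<open>\<beta> ^ j\<close>, are as many as dimension \<open>D\<close> requires.
\<close>

definition \<beta> :: real where
  "\<beta> = 2 powr (- 1 / D)"

text \<open>Level \<open>j\<close> receives mass \<open>(\<kappa> * \<beta> ^ j)\<^sup>2\<close>, so
  \<open>\<kappa> * \<beta> ^ j\<close> is the L2 norm of its indicator.\<close>

definition \<kappa> :: real where
  "\<kappa> = sqrt (1 - \<beta>\<^sup>2)"

lemma \<beta>: "0 < \<beta>" "\<beta> < 1"
  using D powr_less_mono[of "- 1 / D" 0 2] by (auto simp: \<beta>_def)

lemma \<beta>_square: "0 < \<beta>\<^sup>2" "\<beta>\<^sup>2 < 1"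
  using \<beta> by (auto simp: abs_square_less_1)

lemma \<kappa>: "0 < \<kappa>" "\<kappa> < 1" "\<kappa>\<^sup>2 = 1 - \<beta>\<^sup>2"
  using \<beta>_square by (auto simp: \<kappa>_def)

text \<open>The flag \<open>True\<close> marks the rare side. The geometric law of the level, with
  ratio \<open>\<beta>\<^sup>2\<close>, gives rows of level \<open>j\<close> a norm of order
  \<open>\<beta> ^ j\<close>. \<open>None\<close> has mass 0 and is only a limit point.\<close>

definition node_pmf :: "node pmf" where
  "node_pmf = map_pmf Some (pair_pmf (bernoulli_pmf \<delta>)
     (bind_pmf (geometric_pmf (1 - \<beta>\<^sup>2)) (\<lambda>j. pmf_of_set {x. length x = j})))"

lemma pmf_node_pmf:
  "pmf node_pmf (Some (s, x)) = (if s then \<delta> else 1 - \<delta>) * (\<kappa>\<^sup>2 * (\<beta>\<^sup>2 / 2) ^ length x)"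
proof -
  have ne: "{x :: bool list. length x = j} \<noteq> {}" for j
    using Ex_list_of_length by auto
  have "pmf (bind_pmf (geometric_pmf (1 - \<beta>\<^sup>2)) (\<lambda>j. pmf_of_set {x. length x = j})) x
      = (\<integral>j. indicator {y. length y = j} x / 2 ^ j \<partial>geometric_pmf (1 - \<beta>\<^sup>2))"
    unfolding pmf_bind by (intro Bochner_Integration.integral_cong refl) (simp add: pmf_of_set[OF ne])
  also have "\<dots> = \<kappa>\<^sup>2 * (\<beta>\<^sup>2 / 2) ^ length x"
    using \<beta>_square
    by (subst integral_measure_pmf_real[where A = "{length x}"])
       (auto simp: \<kappa> power_divide split: split_indicator_asm)
  finally show ?thesis
    using \<delta> by (auto simp: node_pmf_def pmf_map_inj' pmf_pair)
qed

lemma pmf_node_pmf_pos: "pmf node_pmf (Some u) > 0"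
  using \<delta> \<kappa>(1,2) \<beta> by (cases u) (auto simp: pmf_node_pmf)

definition kernel :: "node \<Rightarrow> node \<Rightarrow> real" where
  "kernel = walsh_kernel c"

lemma kernel_bounds: "0 \<le> kernel u v" "kernel u v \<le> c"
proof -
  have "0 \<le> walsh_kernel c u v \<and> walsh_kernel c u v \<le> c"
  proof (cases u; cases v)
    fix a b assume "u = Some a" "v = Some b"
    then show ?thesis
      using c walsh_cases[of "snd a" "snd b"] by (cases a; cases b) auto
  qed (use c in auto)
  then show "0 \<le> kernel u v" "kernel u v \<le> c" by (auto simp: kernel_def)
qed

definition node_dist :: "node \<Rightarrow> node \<Rightarrow> real" where
  "node_dist u v = sqrt (\<integral>z. \<bar>kernel u z - kernel v z\<bar>\<^sup>2 \<partial>node_pmf)"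

lemma node_dist_square:
  assumes "level u \<le> J" "level v \<le> J"
  shows "(node_dist u v)\<^sup>2 = (\<Sum>z\<in>nodes J. (kernel u z - kernel v z)\<^sup>2 * pmf node_pmf z)"
proof -
  have "(node_dist u v)\<^sup>2 = (\<integral>z. (kernel u z - kernel v z)\<^sup>2 \<partial>node_pmf)"
    by (simp add: node_dist_def)
  also have "\<dots> = (\<Sum>z\<in>nodes J. (kernel u z - kernel v z)\<^sup>2 * pmf node_pmf z)"
  proof (intro integral_measure_pmf_real)
    fix z assume "(kernel u z - kernel v z)\<^sup>2 \<noteq> 0"
    then show "z \<in> nodes J"
      using walsh_kernel_eq_0[OF assms(1)] walsh_kernel_eq_0[OF assms(2)]
      by (cases "z \<in> nodes J") (auto simp: kernel_def)
  qed auto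
  finally show ?thesis .
qed

lemma node_dist_nonneg: "0 \<le> node_dist u v"
  by (simp add: node_dist_def)

text \<open>With the weights absorbed as square roots the distance is a finite Euclidean norm, and
  the triangle inequality becomes Minkowski's inequality.\<close>

lemma node_dist_eq_L2_set:
  assumes "level u \<le> J" "level v \<le> J"
  shows "node_dist u v = L2_set (\<lambda>z. sqrt (pmf node_pmf z) * (kernel u z - kernel v z)) (nodes J)"
proof -
  have "node_dist u v = sqrt ((node_dist u v)\<^sup>2)" by (simp add: node_dist_nonneg)
  then show ?thesis
    by (simp add: node_dist_square[OF assms] L2_set_def power_mult_distrib mult.commute)
qed

lemma node_dist_triangle: "node_dist u w \<le> node_dist u v + node_dist v w"
proof -
  \<comment> \<open>A common bound on the levels lets the three norms run over the same index
    set.\<close>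
  define J where "J = max (level u) (max (level v) (level w))"
  have J: "level u \<le> J" "level v \<le> J" "level w \<le> J" by (auto simp: J_def)
  have "node_dist u w = L2_set (\<lambda>z. sqrt (pmf node_pmf z) * (kernel u z - kernel v z)
      + sqrt (pmf node_pmf z) * (kernel v z - kernel w z)) (nodes J)"
    by (simp add: node_dist_eq_L2_set[OF J(1,3)] algebra_simps)
  also have "\<dots> \<le> node_dist u v + node_dist v w"
    unfolding node_dist_eq_L2_set[OF J(1,2)] node_dist_eq_L2_set[OF J(2,3)]
    by (rule L2_set_triangle_ineq)
  finally show ?thesis .
qed

lemma node_dist_commute: "node_dist u v = node_dist v u"
  by (simp add: node_dist_def abs_minus_commute)

text \<open>Rows take values between 0 and \<open>c\<close>. Thus a small \<open>c\<close> makes the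
  diameter small, which serves the mass condition.\<close>

lemma node_dist_le: "node_dist u v \<le> c"
proof -
  have le: "\<bar>kernel u z - kernel v z\<bar>\<^sup>2 \<le> c\<^sup>2" for z
    using kernel_bounds[of u z] kernel_bounds[of v z] by (intro power_mono) auto
  have "(\<integral>z. \<bar>kernel u z - kernel v z\<bar>\<^sup>2 \<partial>node_pmf) \<le> (\<integral>z. c\<^sup>2 \<partial>node_pmf)"
    using le by (intro integral_mono measure_pmf.integrable_const_bound[where B = "c\<^sup>2"]) auto
  also have "(\<integral>z. c\<^sup>2 \<partial>node_pmf) = c\<^sup>2" by simp
  finally have "node_dist u v \<le> sqrt (c\<^sup>2)"
    unfolding node_dist_def by (rule real_sqrt_le_mono)
  then show ?thesis using c by simp
qed

text \<open>Nodes of one side and one level have equal mass, so a weighted sum over them is the mass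
  of that part times a plain average.\<close>

lemma level_sum:
  "(\<Sum>y | length y = n. f y * pmf node_pmf (Some (s, y)))
     = (if s then \<delta> else 1 - \<delta>) * \<kappa>\<^sup>2 * (\<beta> ^ n)\<^sup>2 * ((\<Sum>y | length y = n. f y) / 2 ^ n)"
proof -
  have "(\<Sum>y | length y = n. f y * pmf node_pmf (Some (s, y)))
      = (\<Sum>y | length y = n. f y * ((if s then \<delta> else 1 - \<delta>) * (\<kappa>\<^sup>2 * (\<beta>\<^sup>2 / 2) ^ n)))"
    by (intro sum.cong) (auto simp: pmf_node_pmf)
  also have "(\<beta>\<^sup>2 / 2) ^ n = (\<beta> ^ n)\<^sup>2 / 2 ^ n"
    by (simp add: power_divide power_even_eq flip: power_mult)
  finally show ?thesis
    by (simp add: sum_distrib_left sum_divide_distrib mult_ac)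
qed

text \<open>The row of \<open>None\<close> is 0, and the row of \<open>u\<close> is at most
  \<open>c\<close> on a part of mass at most \<open>(\<beta> ^ n)\<^sup>2\<close>, level
  \<open>n\<close> of the opposite side. So the levels converge to \<open>None\<close>.\<close>

lemma node_dist_None:
  assumes u: "u = Some (s, x)" and n: "length x = n"
  shows "node_dist u None \<le> c * \<beta> ^ n"
proof -
  let ?A = "{y :: bool list. length y = n}"
  have "(node_dist u None)\<^sup>2 = (\<integral>z. (kernel u z)\<^sup>2 \<partial>node_pmf)"
    by (simp add: node_dist_def kernel_def)
  also have "\<dots> = (\<Sum>z\<in>(\<lambda>y. Some (\<not> s, y)) ` ?A. (kernel u z)\<^sup>2 * pmf node_pmf z)"
  proof (intro integral_measure_pmf_real)
    fix z assume "(kernel u z)\<^sup>2 \<noteq> 0"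
    then show "z \<in> (\<lambda>y. Some (\<not> s, y)) ` ?A"
      using n by (cases z) (auto simp: u kernel_def split: if_splits)
  qed auto
  also have "\<dots> = (\<Sum>y\<in>?A. (kernel u (Some (\<not> s, y)))\<^sup>2 * pmf node_pmf (Some (\<not> s, y)))"
    by (subst sum.reindex) (auto simp: inj_on_def)
  also have "\<dots> \<le> (\<Sum>y\<in>?A. c\<^sup>2 * pmf node_pmf (Some (\<not> s, y)))"
    using kernel_bounds by (intro sum_mono mult_right_mono power_mono) auto
  also have "\<dots> = (if \<not> s then \<delta> else 1 - \<delta>) * \<kappa>\<^sup>2 * (\<beta> ^ n)\<^sup>2 * c\<^sup>2"
    by (subst level_sum) simp
  also have "\<dots> \<le> 1 * 1 * (\<beta> ^ n)\<^sup>2 * c\<^sup>2"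
    using \<delta> \<kappa> \<beta>_square by (intro mult_right_mono mult_mono) auto
  finally have "(node_dist u None)\<^sup>2 \<le> (c * \<beta> ^ n)\<^sup>2"
    by (simp add: power_mult_distrib mult.commute)
  then show ?thesis
    by (rule power2_le_imp_le) (use c \<beta> in auto)
qed

text \<open>Only level \<open>n\<close> of the side opposite to \<open>u\<close> is integrated over;
  the leading factor is the mass of that side. There the squared difference has average at least
  \<open>c\<^sup>2 / 8\<close>: by orthogonality if \<open>v\<close> has the side and level of
  \<open>u\<close>, by the shift of the kernel if not.\<close>

lemma node_dist_square_ge:
  assumes u: "u = Some (s, x)" and n: "length x = n" and "v \<noteq> u"
  shows "(if s then 1 - \<delta> else \<delta>) * (\<kappa> * c * \<beta> ^ n)\<^sup>2 / 8 \<le> (node_dist u v)\<^sup>2"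
proof -
  let ?A = "{y :: bool list. length y = n}"
  define J where "J = max (level u) (level v)"
  define f where "f y = (kernel u (Some (\<not> s, y)) - kernel v (Some (\<not> s, y)))\<^sup>2" for y
  have "c\<^sup>2 / 8 * 2 ^ n \<le> sum f ?A"
  proof (cases "\<exists>x'. v = Some (s, x') \<and> length x' = n")
    case True
    then obtain x' where v: "v = Some (s, x')" "length x' = n" by blast
    then have "x \<noteq> x'" using assms by auto
    \<comment> \<open>Signs square to 1, so the squared difference of two of them is twice 1 minus
      their product; the kernel contributes the factor \<open>(c / 4)\<^sup>2\<close>.\<close>
    have "f y = c\<^sup>2 / 8 * (1 - walsh x y * walsh x' y)" if "y \<in> ?A" for y
      using that n v walsh_cases[of x y] walsh_cases[of x' y]
      by (auto simp: f_def u kernel_def power2_eq_square algebra_simps)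
    then have "sum f ?A = (\<Sum>y\<in>?A. c\<^sup>2 / 8 * (1 - walsh x y * walsh x' y))"
      by (intro sum.cong refl)
    also have "\<dots> = c\<^sup>2 / 8 * (\<Sum>y\<in>?A. 1 - walsh x y * walsh x' y)"
      by (rule sum_distrib_left[symmetric])
    also have "\<dots> = c\<^sup>2 / 8 * 2 ^ n"
      using \<open>x \<noteq> x'\<close> by (simp add: sum_subtractf walsh_orthogonal[OF n v(2)])
    finally show ?thesis by simp
  next
    case False
    have "c\<^sup>2 / 8 \<le> f y" if "y \<in> ?A" for y
    proof -
      \<comment> \<open>Here \<open>v\<close> is \<open>None\<close> or has another side or level,
        so its row vanishes, while the row of \<open>u\<close> stays above
        \<open>c / 2\<close>.\<close>
      have "kernel v (Some (\<not> s, y)) = 0"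
        using False that by (cases v) (auto simp: kernel_def)
      then have f: "f y = (c * (3 + walsh x y) / 4)\<^sup>2"
        using that n by (simp add: f_def u kernel_def)
      have "c\<^sup>2 / 8 \<le> (c / 2)\<^sup>2" by (simp add: power_divide)
      also have "\<dots> \<le> f y"
        unfolding f using walsh_cases[of x y] c by (intro power_mono) auto
      finally show ?thesis .
    qed
    then have "(\<Sum>y\<in>?A. c\<^sup>2 / 8) \<le> sum f ?A" by (intro sum_mono) auto
    then show ?thesis by (simp add: mult.commute)
  qed
  then have avg: "c\<^sup>2 / 8 \<le> sum f ?A / 2 ^ n" by (simp add: field_simps)
  have "(if s then 1 - \<delta> else \<delta>) * (\<kappa> * c * \<beta> ^ n)\<^sup>2 / 8
      = (if s then 1 - \<delta> else \<delta>) * \<kappa>\<^sup>2 * (\<beta> ^ n)\<^sup>2 * (c\<^sup>2 / 8)"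
    by (simp add: power_mult_distrib mult_ac)
  also have "\<dots> \<le> (if s then 1 - \<delta> else \<delta>) * \<kappa>\<^sup>2 * (\<beta> ^ n)\<^sup>2 * (sum f ?A / 2 ^ n)"
    using avg \<delta> by (intro mult_left_mono) auto
  also have "\<dots> = (\<Sum>y\<in>?A. f y * pmf node_pmf (Some (\<not> s, y)))"
    by (subst level_sum) auto
  also have "\<dots> = (\<Sum>z\<in>(\<lambda>y. Some (\<not> s, y)) ` ?A. (kernel u z - kernel v z)\<^sup>2 * pmf node_pmf z)"
    by (subst sum.reindex) (auto simp: inj_on_def f_def)
  also have "\<dots> \<le> (\<Sum>z\<in>nodes J. (kernel u z - kernel v z)\<^sup>2 * pmf node_pmf z)"
    using n by (intro sum_mono2 finite_nodes) (auto simp: nodes_def J_def u)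
  also have "\<dots> = (node_dist u v)\<^sup>2"
    by (rule node_dist_square[symmetric]) (auto simp: J_def)
  finally show ?thesis .
qed

text \<open>Both sides have mass at least \<open>\<delta>\<close>. The dependence on
  \<open>\<delta>\<close> is harmless for separation of points and completeness, where this bound
  serves.\<close>

lemma node_dist_ge:
  assumes u: "u = Some (s, x)" and n: "length x = n" and "v \<noteq> u"
  shows "sqrt (\<delta> / 8) * (\<kappa> * c * \<beta> ^ n) \<le> node_dist u v"
proof (rule power2_le_imp_le)
  have "\<delta> * (\<kappa> * c * \<beta> ^ n)\<^sup>2 \<le> (if s then 1 - \<delta> else \<delta>) * (\<kappa> * c * \<beta> ^ n)\<^sup>2"
    using \<delta> by (intro mult_right_mono) auto
  with node_dist_square_ge[OF assms]
  show "(sqrt (\<delta> / 8) * (\<kappa> * c * \<beta> ^ n))\<^sup>2 \<le> (node_dist u v)\<^sup>2"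
    using \<delta> by (simp add: power_mult_distrib)
qed (rule node_dist_nonneg)

text \<open>
  On the rare side the bound does not depend on \<open>\<delta>\<close>, since these rows are functions on the
  frequent side. This makes the constants of the covering condition independent of \<open>n\<close>.
\<close>

lemma node_dist_True_ge:
  assumes u: "u = Some (True, x)" and n: "length x = n" and "v \<noteq> u"
  shows "\<kappa> * c * \<beta> ^ n / 4 \<le> node_dist u v"
proof (rule power2_le_imp_le)
  have "1 / 2 * (\<kappa> * c * \<beta> ^ n)\<^sup>2 \<le> (1 - \<delta>) * (\<kappa> * c * \<beta> ^ n)\<^sup>2"
    using \<delta> by (intro mult_right_mono) auto
  with node_dist_square_ge[OF assms]
  show "(\<kappa> * c * \<beta> ^ n / 4)\<^sup>2 \<le> (node_dist u v)\<^sup>2"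
    by (simp add: power_divide)
qed (rule node_dist_nonneg)

lemma node_dist_eq_0_iff: "node_dist u v = 0 \<longleftrightarrow> u = v"
proof -
  have pos: "node_dist (Some u) v > 0" if "v \<noteq> Some u" for u v
  proof -
    obtain s x where "Some u = Some (s, x)" by (cases u) auto
    from node_dist_ge[OF this refl that]
    have "sqrt (\<delta> / 8) * (\<kappa> * c * \<beta> ^ length x) \<le> node_dist (Some u) v" .
    moreover have "0 < sqrt (\<delta> / 8) * (\<kappa> * c * \<beta> ^ length x)"
      using \<delta> \<kappa> c \<beta> by simp
    ultimately show ?thesis by linarith
  qed
  have "node_dist u u = 0" by (simp add: node_dist_def)
  then show ?thesis
    by (metis less_irrefl node_dist_commute not_Some_eq pos)
qed

end

section \<open>From covering numbers to the Minkowski dimension\<close>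

lemma tendsto_affine_ln_ratio:
  fixes a D :: real
  shows "((\<lambda>\<epsilon>. (a + D * (- ln \<epsilon>)) / (- ln \<epsilon>)) \<longlongrightarrow> D) (at_right 0)"
proof -
  have "filterlim (\<lambda>\<epsilon>::real. - ln \<epsilon>) at_infinity (at_right 0)"
    using ln_at_0 by (auto intro: filterlim_at_top_imp_at_infinity simp: filterlim_uminus_at_bot)
  then have "((\<lambda>\<epsilon>. a / (- ln \<epsilon>) + D) \<longlongrightarrow> 0 + D) (at_right 0)"
    by (intro tendsto_add tendsto_const tendsto_divide_0[OF tendsto_const])
  moreover have "\<forall>\<^sub>F \<epsilon> in at_right 0. a / (- ln \<epsilon>) + D = (a + D * (- ln \<epsilon>)) / (- ln \<epsilon>)"
    using eventually_at_right_less[of 0] eventually_at_right_real[of 0 1, OF zero_less_one]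
    by eventually_elim (simp add: field_simps)
  ultimately show ?thesis by (simp add: tendsto_cong)
qed

text \<open>The logarithms of both bounds are affine in \<open>- ln \<epsilon>\<close> with slope
  \<open>D\<close>, and their constants vanish after division.\<close>

lemma has_minkowski_dim_if_covering_number_bounds:
  assumes "v > 0" "0 < m" "0 < M"
    and bounds: "\<And>\<epsilon>. 0 < \<epsilon> \<Longrightarrow> \<epsilon> \<le> v \<Longrightarrow>
      \<exists>N. covering_number \<mu> W \<epsilon> = enat N \<and> m * \<epsilon> powr - D \<le> real N \<and> real N \<le> M * \<epsilon> powr - D"
  shows "has_minkowski_dim \<mu> W D"
proof -
  have lim: "((\<lambda>\<epsilon>. ereal ((ln a + D * (- ln \<epsilon>)) / (- ln \<epsilon>))) \<longlongrightarrow> ereal D) (at_right 0)" for a :: real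
    using tendsto_affine_ln_ratio by (simp only: lim_ereal)
  \<comment> \<open>Below 1 the denominator \<open>- ln \<epsilon>\<close> is positive, so division
    keeps the inequalities.\<close>
  have small: "\<forall>\<^sub>F \<epsilon> in at_right 0. 0 < \<epsilon> \<and> \<epsilon> < min v 1"
    using eventually_at_right_real[of 0 "min v 1"] \<open>v > 0\<close> by (auto elim: eventually_mono)
  have main: "ereal ((ln m + D * (- ln \<epsilon>)) / (- ln \<epsilon>))
        \<le> ln_enat (covering_number \<mu> W \<epsilon>) / ereal (- ln \<epsilon>) \<and>
      ln_enat (covering_number \<mu> W \<epsilon>) / ereal (- ln \<epsilon>)
        \<le> ereal ((ln M + D * (- ln \<epsilon>)) / (- ln \<epsilon>))" if \<epsilon>: "0 < \<epsilon> \<and> \<epsilon> < min v 1" for \<epsilon>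
  proof -
    obtain N where N: "covering_number \<mu> W \<epsilon> = enat N"
        "m * \<epsilon> powr - D \<le> real N" "real N \<le> M * \<epsilon> powr - D"
      using bounds[of \<epsilon>] \<epsilon> by auto
    have pos: "0 < m * \<epsilon> powr - D" using \<epsilon> assms by simp
    have ln_eq: "ln (a * \<epsilon> powr - D) = ln a + D * (- ln \<epsilon>)" if "a > 0" for a
      using that \<epsilon> by (simp add: ln_mult ln_powr)
    have ln_N: "ln m + D * (- ln \<epsilon>) \<le> ln (real N)" "ln (real N) \<le> ln M + D * (- ln \<epsilon>)"
      unfolding ln_eq[OF \<open>0 < m\<close>, symmetric] ln_eq[OF \<open>0 < M\<close>, symmetric]
      using N pos by auto
    have "0 \<le> - ln \<epsilon>" using \<epsilon> by simp
    note ln_N[THEN divide_right_mono, OF this]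
    moreover have "ln_enat (covering_number \<mu> W \<epsilon>) / ereal (- ln \<epsilon>) = ereal (ln (real N) / (- ln \<epsilon>))"
      using \<epsilon> by (simp add: N(1) ln_enat_def)
    ultimately show ?thesis by (simp only: ereal_less_eq simp_thms)
  qed
  show ?thesis
    unfolding has_minkowski_dim_def
  proof (rule tendsto_sandwich[OF _ _ lim[of m] lim[of M]])
    show "\<forall>\<^sub>F \<epsilon> in at_right 0. ereal ((ln m + D * (- ln \<epsilon>)) / (- ln \<epsilon>))
        \<le> ln_enat (covering_number \<mu> W \<epsilon>) / ereal (- ln \<epsilon>)"
      using small by (rule eventually_mono) (rule main[THEN conjunct1])
    show "\<forall>\<^sub>F \<epsilon> in at_right 0. ln_enat (covering_number \<mu> W \<epsilon>) / ereal (- ln \<epsilon>)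
        \<le> ereal ((ln M + D * (- ln \<epsilon>)) / (- ln \<epsilon>))"
      using small by (rule eventually_mono) (rule main[THEN conjunct2])
  qed
qed

section \<open>Purity of the Walsh graphon\<close>

context walsh_graphon
begin

abbreviation \<mu> :: "real measure" where
  "\<mu> \<equiv> encoded_measure node_pmf"

abbreviation W :: "real \<Rightarrow> real \<Rightarrow> real" where
  "W \<equiv> encoded_kernel kernel"

lemma nbhd_dist_encode: "nbhd_dist \<mu> W (encode u) (encode v) = node_dist u v"
  by (simp add: nbhd_dist_encoded node_dist_def)

lemma graphon: "graphon \<mu> W"
proof (rule graphon_encoded)
  show "kernel u v \<le> 1" for u v
    using kernel_bounds[of u v] c by linarith
qed (use kernel_bounds in \<open>auto simp: kernel_def walsh_kernel_commute\<close>)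

sublocale metric: Metric_space "range (encode :: node \<Rightarrow> real)" "nbhd_dist \<mu> W"
proof
  show "0 \<le> nbhd_dist \<mu> W x y" for x y by (simp add: nbhd_dist_def)
  show "nbhd_dist \<mu> W x y = nbhd_dist \<mu> W y x" for x y
    by (simp add: nbhd_dist_def abs_minus_commute)
next
  fix x y assume "x \<in> range (encode :: node \<Rightarrow> real)" "y \<in> range (encode :: node \<Rightarrow> real)"
  then show "nbhd_dist \<mu> W x y = 0 \<longleftrightarrow> x = y"
    by (auto simp: nbhd_dist_encode node_dist_eq_0_iff)
next
  fix x y z assume "x \<in> range (encode :: node \<Rightarrow> real)" "y \<in> range (encode :: node \<Rightarrow> real)" "z \<in> range (encode :: node \<Rightarrow> real)"
  then show "nbhd_dist \<mu> W x z \<le> nbhd_dist \<mu> W x y + nbhd_dist \<mu> W y z"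
    by (auto simp: nbhd_dist_encode intro: node_dist_triangle)
qed

lemma mcomplete: "metric.mcomplete"
proof (rule metric.mcomplete_if_isolated_away_from_point)
  show "encode (None :: node) \<in> range (encode :: node \<Rightarrow> real)" by simp
  fix \<epsilon> :: real assume "\<epsilon> > 0"
  \<comment> \<open>A node of level \<open>n\<close> at distance at least \<open>\<epsilon>\<close>
    from \<open>None\<close> has \<open>\<epsilon> \<le> c * \<beta> ^ n\<close>; inserted into
    \<open>node_dist_ge\<close>, this gives the isolation radius.\<close>
  define \<eta> where "\<eta> = sqrt (\<delta> / 8) * \<kappa> * \<epsilon>"
  have isolated: "v = u" if "\<epsilon> \<le> node_dist u None" "node_dist u v < \<eta>" for u v
  proof (rule ccontr)
    assume "v \<noteq> u"
    have "u \<noteq> None" using that \<open>\<epsilon> > 0\<close> node_dist_eq_0_iff[of u None] by auto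
    then obtain s x where u: "u = Some (s, x)" by auto
    have "\<epsilon> \<le> c * \<beta> ^ length x"
      using that(1) node_dist_None[OF u refl] by linarith
    then have "\<eta> \<le> sqrt (\<delta> / 8) * \<kappa> * (c * \<beta> ^ length x)"
      unfolding \<eta>_def using \<delta> \<kappa> by (intro mult_left_mono) auto
    also have "\<dots> \<le> node_dist u v"
      using node_dist_ge[OF u refl \<open>v \<noteq> u\<close>] by (simp add: mult_ac)
    finally show False using that by linarith
  qed
  show "\<exists>\<eta>>0. \<forall>x\<in>range (encode :: node \<Rightarrow> real). \<forall>y\<in>range (encode :: node \<Rightarrow> real). \<epsilon> \<le> nbhd_dist \<mu> W x (encode (None :: node)) \<longrightarrow>
      nbhd_dist \<mu> W x y < \<eta> \<longrightarrow> y = x"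
  proof (intro exI[of _ \<eta>] conjI)
    show "\<eta> > 0" using \<open>\<epsilon> > 0\<close> \<delta> \<kappa> by (simp add: \<eta>_def)
  qed (use isolated in \<open>auto simp: nbhd_dist_encode\<close>)
qed

text \<open>Every ball contains a node of positive mass: its center or, around \<open>None\<close>,
  a node of high level.\<close>

lemma emeasure_ball_pos:
  assumes "x \<in> space \<mu>" "\<epsilon> > 0"
  shows "emeasure \<mu> (graphon_ball \<mu> W x \<epsilon>) > 0"
proof -
  obtain u :: node where x: "x = encode u" using assms by auto
  have "\<exists>v. node_dist u (Some v) < \<epsilon>"
  proof (cases u)
    case None
    obtain j where j: "\<beta> ^ j < \<epsilon>" using real_arch_pow_inv[OF \<open>\<epsilon> > 0\<close> \<beta>(2)] by blast
    have "node_dist None (Some (True, replicate j True)) \<le> c * \<beta> ^ j"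
      using node_dist_None[OF refl, of "replicate j True" j True] by (simp add: node_dist_commute)
    also have "\<dots> \<le> 1 * \<beta> ^ j" using c \<beta> by (intro mult_right_mono) auto
    finally show ?thesis using j None by (metis le_less_trans mult_1)
  next
    case (Some v)
    then show ?thesis using \<open>\<epsilon> > 0\<close> node_dist_eq_0_iff by metis
  qed
  then obtain v where v: "node_dist u (Some v) < \<epsilon>" by blast
  have "0 < ennreal (pmf node_pmf (Some v))" using pmf_node_pmf_pos by simp
  also have "\<dots> = emeasure \<mu> (encode ` {Some v})"
    unfolding emeasure_encoded_measure by (simp add: emeasure_pmf_single)
  also have "\<dots> \<le> emeasure \<mu> (graphon_ball \<mu> W x \<epsilon>)"
    using v by (intro emeasure_mono) (auto simp: x nbhd_dist_encode)
  finally show ?thesis .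
qed

lemma pure_graphon: "pure_graphon \<mu> W"
proof -
  \<comment> \<open>The space is countable, hence its own countable dense subset.\<close>
  have "separable_space metric.mtopology"
    unfolding separable_space_def using closure_of_topspace[of metric.mtopology]
    by (intro exI[of _ "space \<mu>"]) simp
  then show ?thesis
    using graphon metric.Metric_space_axioms mcomplete emeasure_ball_pos
    by (simp add: pure_graphon_def)
qed

section \<open>Covering numbers and the two conditions\<close>

text \<open>The ball around \<open>None\<close> contains all levels above \<open>J\<close>, and the
  at most \<open>4 * 2 ^ J - 2\<close> nodes up to level \<open>J\<close> serve as their own
  centers.\<close>

lemma covering_number_upper:
  assumes "0 < \<epsilon>" "\<epsilon> < c"
  obtains N where "covering_number \<mu> W \<epsilon> = enat N" "real N \<le> 4 * (c / \<epsilon>) powr D"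
proof -
  obtain J where J: "\<beta> ^ Suc J < \<epsilon> / c" "2 ^ J \<le> (\<epsilon> / c) powr - D"
    using dyadic_scale[of D "\<epsilon> / c"] D c assms unfolding \<beta>_def by auto
  define C where "C = (encode :: node \<Rightarrow> real) ` insert None (nodes J)"
  have "card C \<le> card (insert None (nodes J))"
    unfolding C_def by (intro card_image_le) simp
  also have "\<dots> \<le> Suc (2 * (2 ^ Suc J - 1))"
    by (simp add: card_insert_if card_nodes)
  also have "\<dots> \<le> 4 * 2 ^ J"
  proof -
    have "1 \<le> (2 :: nat) ^ J" by simp
    then show ?thesis unfolding power_Suc by linarith
  qed
  finally have "real (card C) \<le> real (4 * 2 ^ J)" by (simp only: of_nat_le_iff)
  also have "\<dots> \<le> 4 * (c / \<epsilon>) powr D"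
    using J(2) c assms by (simp add: powr_minus powr_divide)
  finally have card: "real (card C) \<le> 4 * (c / \<epsilon>) powr D" .
  have "x \<in> (\<Union>c\<in>C. graphon_cball \<mu> W c \<epsilon>)" if x_in: "x \<in> space \<mu>" for x
  proof -
    obtain u :: node where x: "x = encode u" using x_in by auto
    show ?thesis
    proof (cases "u \<in> insert None (nodes J)")
      case True
      then show ?thesis
        using assms by (intro UN_I[of x]) (auto simp: x C_def)
    next
      case False
      then obtain s y where u: "u = Some (s, y)" by (cases u) auto
      have y: "Suc J \<le> length y"
        using False by (auto simp: u nodes_def not_less_eq_eq)
      have "node_dist None u \<le> c * \<beta> ^ length y"
        using node_dist_None[OF u refl] by (simp add: node_dist_commute)
      also have "\<dots> \<le> c * \<beta> ^ Suc J"
        using y c \<beta> by (intro mult_left_mono power_decreasing) auto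
      also have "\<dots> \<le> \<epsilon>" using J(1) c by (simp add: field_simps)
      finally show ?thesis
        by (intro UN_I[of "encode (None :: node)"]) (auto simp: x C_def nbhd_dist_encode)
    qed
  qed
  then have "space \<mu> \<subseteq> (\<Union>c\<in>C. graphon_cball \<mu> W c \<epsilon>)" by (rule subsetI)
  moreover have "finite C" "C \<subseteq> space \<mu>" by (auto simp: C_def)
  ultimately have "covering_number \<mu> W \<epsilon> \<le> enat (card C)"
    unfolding covering_number_def by (intro INF_lower CollectI conjI)
  then obtain N where "covering_number \<mu> W \<epsilon> = enat N" "N \<le> card C"
    by (cases "covering_number \<mu> W \<epsilon>") auto
  then show thesis using card that[of N] by simp
qed

text \<open>The \<open>2 ^ J\<close> rare nodes of level \<open>J\<close> are more than
  \<open>2 * \<epsilon>\<close> apart, so no ball of radius \<open>\<epsilon>\<close> contains two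
  of them and the centers are at least as many.\<close>

lemma covering_number_lower:
  assumes "0 < \<epsilon>" "\<epsilon> \<le> \<kappa> / 32 * c" and N: "covering_number \<mu> W \<epsilon> = enat N"
  shows "(\<kappa> / 16) powr D / 2 * (c / \<epsilon>) powr D \<le> real N"
proof -
  \<comment> \<open>Separation needs \<open>8 * \<epsilon> < \<kappa> * c * \<beta> ^ J\<close>; the
    factor 16 makes it strict. The bound \<open>\<kappa> / 32 * c\<close> on the radius keeps this
    scale at most 1/2.\<close>
  have "16 * \<epsilon> / (\<kappa> * c) < 1" "0 < 16 * \<epsilon> / (\<kappa> * c)"
    using assms \<kappa>(1) c mult_pos_pos[OF \<kappa>(1) c(1)] by (auto simp: field_simps)
  then obtain J where J: "16 * \<epsilon> / (\<kappa> * c) \<le> \<beta> ^ J" "(16 * \<epsilon> / (\<kappa> * c)) powr - D \<le> 2 ^ Suc J"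
    using dyadic_scale[of D "16 * \<epsilon> / (\<kappa> * c)"] D unfolding \<beta>_def by metis
  have sep: "2 * \<epsilon> < \<kappa> * c * \<beta> ^ J / 4"
  proof -
    have "16 * \<epsilon> \<le> \<kappa> * c * \<beta> ^ J" using J(1) \<kappa> c by (simp add: field_simps)
    then show ?thesis using assms by linarith
  qed
  let ?L = "{x :: bool list. length x = J}"
  have "2 ^ J \<le> card C" if C: "finite C" "C \<subseteq> space \<mu>" "space \<mu> \<subseteq> (\<Union>c\<in>C. graphon_cball \<mu> W c \<epsilon>)" for C
  proof -
    have "\<exists>w. encode w \<in> C \<and> node_dist w (Some (True, x)) \<le> \<epsilon>" for x
    proof -
      have "encode (Some (True, x)) \<in> (\<Union>c\<in>C. graphon_cball \<mu> W c \<epsilon>)"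
        using C(3) by (rule subsetD) simp
      then obtain y where "y \<in> C" "y \<in> space \<mu>" "nbhd_dist \<mu> W y (encode (Some (True, x))) \<le> \<epsilon>"
        by auto
      then show ?thesis by (auto simp: nbhd_dist_encode)
    qed
    then obtain g where g: "\<And>x. encode (g x) \<in> C" "\<And>x. node_dist (g x) (Some (True, x)) \<le> \<epsilon>"
      by metis
    have "inj_on (\<lambda>x. encode (g x)) ?L"
    proof (rule inj_onI, rule ccontr)
      fix x x' assume x: "x \<in> ?L" "x' \<in> ?L" "encode (g x) = encode (g x')" and "x \<noteq> x'"
      have "node_dist (Some (True, x)) (Some (True, x')) \<le> 2 * \<epsilon>"
        using node_dist_triangle[of "Some (True, x)" "Some (True, x')" "g x"] g(2)[of x] g(2)[of x'] x(3)
        by (simp add: node_dist_commute)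
      moreover have "\<kappa> * c * \<beta> ^ J / 4 \<le> node_dist (Some (True, x)) (Some (True, x'))"
        using x \<open>x \<noteq> x'\<close> by (intro node_dist_True_ge[OF refl]) auto
      ultimately show False using sep by linarith
    qed
    then have "card ?L \<le> card C"
      using g C by (intro card_inj_on_le[of "\<lambda>x. encode (g x)"]) auto
    then show ?thesis by simp
  qed
  then have "enat (2 ^ J) \<le> covering_number \<mu> W \<epsilon>"
    unfolding covering_number_def by (intro INF_greatest) auto
  then have "2 ^ J \<le> N" by (simp add: N)
  then have "2 ^ J \<le> real N" by (metis of_nat_le_iff of_nat_numeral of_nat_power)
  moreover have "(16 * \<epsilon> / (\<kappa> * c)) powr - D = (\<kappa> / 16) powr D * (c / \<epsilon>) powr D"
    using \<kappa>(1) c assms by (simp add: powr_minus powr_divide powr_mult)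
  ultimately show ?thesis using J(2) unfolding power_Suc by linarith
qed

lemma covering_number_bounds:
  assumes "0 < \<epsilon>" "\<epsilon> \<le> \<kappa> / 32 * c"
  shows "\<exists>N. covering_number \<mu> W \<epsilon> = enat N \<and>
    (\<kappa> / 16) powr D / 2 * (c / \<epsilon>) powr D \<le> real N \<and> real N \<le> 4 * (c / \<epsilon>) powr D"
proof -
  have "\<kappa> / 32 * c < 1 * c" using \<kappa> c by (intro mult_strict_right_mono) auto
  then have "\<epsilon> < c" using assms by simp
  then obtain N where "covering_number \<mu> W \<epsilon> = enat N" "real N \<le> 4 * (c / \<epsilon>) powr D"
    using covering_number_upper assms by blast
  then show ?thesis
    using covering_number_lower[OF assms] by blast
qed

text \<open>Scaling the kernel affects only the constants, through \<open>c powr D\<close>.\<close>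

lemma has_minkowski_dim: "has_minkowski_dim \<mu> W D"
proof (rule has_minkowski_dim_if_covering_number_bounds)
  show "0 < \<kappa> / 32 * c" "0 < (\<kappa> / 16) powr D / 2 * c powr D" "0 < 4 * c powr D"
    using \<kappa>(1) c by auto
  fix \<epsilon> assume \<epsilon>: "0 < \<epsilon>" "\<epsilon> \<le> \<kappa> / 32 * c"
  have "(c / \<epsilon>) powr D = c powr D * \<epsilon> powr - D"
    using c \<epsilon> by (simp add: powr_divide powr_minus_divide)
  then show "\<exists>N. covering_number \<mu> W \<epsilon> = enat N \<and>
      (\<kappa> / 16) powr D / 2 * c powr D * \<epsilon> powr - D \<le> real N \<and> real N \<le> 4 * c powr D * \<epsilon> powr - D"
    using covering_number_bounds[OF \<epsilon>] by (simp add: mult.assoc)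
qed

lemmas minkowski_dim = minkowski_dim_eqI[OF has_minkowski_dim]

text \<open>Since \<open>\<kappa>\<close> depends on \<open>D\<close> alone, the constants are the
  same for all \<open>\<delta>\<close>, hence for all \<open>n\<close>.\<close>

lemma covering_condition:
  assumes "c = 1"
  shows "covering_condition n ((\<kappa> / 16) powr D / 2) 4 (\<kappa> / 32) \<mu> W"
  unfolding covering_condition_def minkowski_dim
proof
  fix \<epsilon> assume "\<epsilon> \<in> {1 / real n<..\<kappa> / 32}"
  moreover have "0 \<le> 1 / real n" by simp
  ultimately have "0 < \<epsilon>" "\<epsilon> \<le> \<kappa> / 32"
    unfolding greaterThanAtMost_iff by linarith+
  then have \<epsilon>: "0 < \<epsilon>" "\<epsilon> \<le> \<kappa> / 32 * c"
    using assms by auto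
  obtain N where N: "covering_number \<mu> W \<epsilon> = enat N"
    "(\<kappa> / 16) powr D / 2 * (c / \<epsilon>) powr D \<le> real N" "real N \<le> 4 * (c / \<epsilon>) powr D"
    using covering_number_bounds[OF \<epsilon>] by blast
  moreover have "(c / \<epsilon>) powr D = \<epsilon> powr - D"
    using \<epsilon> assms by (simp add: powr_divide powr_minus_divide)
  ultimately show "ereal ((\<kappa> / 16) powr D / 2 * \<epsilon> powr - D) \<le> ereal_of_enat (covering_number \<mu> W \<epsilon>) \<and>
      ereal_of_enat (covering_number \<mu> W \<epsilon>) \<le> ereal (4 * \<epsilon> powr - D)"
    by simp
qed

text \<open>The diameter is at most \<open>c\<close>, below every required radius, so each ball is
  the whole space and has mass 1, while \<open>\<epsilon> powr D \<le> 1\<close>.\<close>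

lemma mass_condition:
  assumes "c < 1 / real n"
  shows "mass_condition n 1 (\<kappa> / 32) \<mu> W"
  unfolding mass_condition_def minkowski_dim
proof (intro ballI)
  fix x \<epsilon> assume x: "x \<in> space \<mu>" and "\<epsilon> \<in> {1 / real n<..\<kappa> / 32}"
  then have \<epsilon>: "c < \<epsilon>" "\<epsilon> \<le> 1" using assms \<kappa> by auto
  have "nbhd_dist \<mu> W x y < \<epsilon>" if y: "y \<in> space \<mu>" for y
  proof -
    obtain u w :: node where "x = encode u" "y = encode w" using x y by auto
    then show ?thesis using node_dist_le[of u w] \<epsilon>(1) by (simp add: nbhd_dist_encode)
  qed
  then have "graphon_ball \<mu> W x \<epsilon> = space \<mu>" using x by auto
  then have "measure \<mu> (graphon_ball \<mu> W x \<epsilon>) = 1"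
    by (simp only: prob_space.prob_space[OF prob_space_encoded_measure])
  moreover have "\<epsilon> powr D \<le> 1" using \<epsilon> c D by (intro powr_le1) auto
  ultimately show "1 * \<epsilon> powr D \<le> measure \<mu> (graphon_ball \<mu> W x \<epsilon>)" by simp
qed

text \<open>The nodes off the rare side have mass \<open>1 - \<delta>\<close> and no edges among
  them; Bernoulli's inequality bounds the \<open>n\<close>-th power of this mass.\<close>

lemma zero_adj_matrix_likely:
  assumes "real n * \<delta> \<le> 1 / 2"
  shows "ennreal (1 / 2) \<le> emeasure (W_random_graph n \<mu> W) {\<lambda>i j. 0}"
proof -
  define S :: "node set" where "S = {u. \<forall>x. u \<noteq> Some (True, x)}"
  \<comment> \<open>Pulled back along \<open>Some\<close>, the set depends on the flag alone, so its
    mass comes from the Bernoulli marginal.\<close>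
  have S: "Some -` S = fst -` {False}"
  proof (rule set_eqI)
    show "p \<in> Some -` S \<longleftrightarrow> p \<in> fst -` {False}" for p by (cases p) (simp add: S_def)
  qed
  have "emeasure \<mu> (encode ` S) = emeasure (measure_pmf node_pmf) S"
    by (rule emeasure_encoded_measure)
  also have "\<dots> = emeasure (measure_pmf (bernoulli_pmf \<delta>)) {False}"
    unfolding node_pmf_def emeasure_map_pmf S
    by (subst emeasure_map_pmf[symmetric]) (simp only: map_fst_pair_pmf)
  also have "\<dots> = ennreal (1 - \<delta>)" using \<delta> by (simp add: emeasure_pmf_single)
  finally have G: "emeasure \<mu> (encode ` S) = ennreal (1 - \<delta>)" .
  have "1 / 2 \<le> 1 + real n * (- \<delta>)" using assms by simp
  also have "\<dots> \<le> (1 + - \<delta>) ^ n" using \<delta> by (intro Bernoulli_inequality) auto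
  finally have "1 / 2 \<le> (1 - \<delta>) ^ n" by simp
  then have "ennreal (1 / 2) \<le> ennreal ((1 - \<delta>) ^ n)" by (rule ennreal_leI)
  also have "\<dots> = emeasure \<mu> (encode ` S) ^ n"
    using \<delta> by (simp add: G ennreal_power)
  also have "\<dots> \<le> emeasure (W_random_graph n \<mu> W) {\<lambda>i j. 0}"
  proof (rule power_le_emeasure_W_random_graph_zero[OF graphon])
    fix x y assume "x \<in> encode ` S" "y \<in> encode ` S"
    then obtain u v where "x = encode u" "y = encode v" "u \<in> S" "v \<in> S" by auto
    then show "W x y = 0" by (cases u; cases v) (auto simp: S_def kernel_def)
  qed auto
  finally show ?thesis .
qed

end

subsection \<open>The one-point graphon\<close>

abbreviation point_measure :: "real measure" where
  "point_measure \<equiv> encoded_measure (return_pmf ())"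

abbreviation zero_kernel :: "real \<Rightarrow> real \<Rightarrow> real" where
  "zero_kernel \<equiv> encoded_kernel (\<lambda>(_ :: unit) _. 0)"

lemma Metric_space_point: "Metric_space (range (encode :: unit \<Rightarrow> real)) (nbhd_dist point_measure zero_kernel)"
  by unfold_locales (auto simp: nbhd_dist_def encoded_kernel_def)

lemma covering_number_point:
  assumes "\<epsilon> > 0"
  shows "covering_number point_measure zero_kernel \<epsilon> = 1"
proof -
  have space: "space point_measure = {encode ()}" by (auto simp: UNIV_unit)
  have cball: "graphon_cball point_measure zero_kernel (encode ()) \<epsilon> = {encode ()}"
    using assms Metric_space_point
    by (auto simp: Metric_space.in_mcball Metric_space.mcball_def space nbhd_dist_def encoded_kernel_def)
  have "{C. finite C \<and> C \<subseteq> space point_measure \<and>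
      space point_measure \<subseteq> (\<Union>c\<in>C. graphon_cball point_measure zero_kernel c \<epsilon>)} = {{encode ()}}"
    unfolding space using cball[unfolded space] by (auto simp: subset_singleton_iff)
  then show ?thesis
    by (simp add: covering_number_def one_enat_def)
qed

lemma has_minkowski_dim_point: "has_minkowski_dim point_measure zero_kernel 0"
  by (rule has_minkowski_dim_if_covering_number_bounds[of 1 1 1])
     (auto simp: covering_number_point one_enat_def)

lemma graphon_ball_point:
  assumes "x \<in> space point_measure" "\<epsilon> > 0"
  shows "graphon_ball point_measure zero_kernel x \<epsilon> = space point_measure"
  using assms Metric_space_point
  by (auto simp: Metric_space.mball_def nbhd_dist_def encoded_kernel_def)

lemma pure_graphon_point: "pure_graphon point_measure zero_kernel"
proof -
  interpret P: Metric_space "range (encode :: unit \<Rightarrow> real)" "nbhd_dist point_measure zero_kernel"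
    by (rule Metric_space_point)
  interpret prob_space point_measure by (rule prob_space_encoded_measure)
  have "P.mcomplete"
    by (rule P.mcomplete_if_isolated_away_from_point[of "encode ()"]) (auto simp: UNIV_unit intro: exI[of _ 1])
  moreover have "separable_space P.mtopology"
    unfolding separable_space_def using closure_of_topspace[of P.mtopology]
    by (intro exI[of _ "space point_measure"]) simp
  moreover have "0 < emeasure point_measure (graphon_ball point_measure zero_kernel x \<epsilon>)"
    if "x \<in> space point_measure" "\<epsilon> > 0" for x \<epsilon>
    unfolding graphon_ball_point[OF that] emeasure_space_1 by simp
  moreover have "graphon point_measure zero_kernel" by (rule graphon_encoded) auto
  ultimately show ?thesis
    using P.Metric_space_axioms by (simp add: pure_graphon_def)
qed

text \<open>In dimension 0 both conditions are comparisons with 1: the covering number lies between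
  \<open>m\<close> and \<open>M\<close>, and the mass 1 of a ball equals \<alpha> = 1.\<close>

lemma point_in_classes:
  assumes "0 < m" "m \<le> 1" "1 \<le> M" "0 \<le> D"
  shows "(point_measure, zero_kernel) \<in> W_min1 n D 1 m M v"
    and "(point_measure, zero_kernel) \<in> W_min2 n D 1 m M v"
proof -
  have dim: "minkowski_dim point_measure zero_kernel = 0"
    by (rule minkowski_dim_eqI[OF has_minkowski_dim_point])
  \<comment> \<open>Positivity matters because \<open>\<epsilon> powr 0\<close> is 1 only for
    nonzero \<open>\<epsilon>\<close>.\<close>
  have pos: "\<epsilon> > 0" if "1 / real n < \<epsilon>" for \<epsilon>
    using that by (rule le_less_trans[rotated]) simp
  have "covering_condition n m M v point_measure zero_kernel"
    using assms pos by (auto simp: covering_condition_def dim covering_number_point one_enat_def)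
  moreover have "mass_condition n 1 v point_measure zero_kernel"
    unfolding mass_condition_def dim
  proof (intro ballI)
    fix x \<epsilon> assume x: "x \<in> space point_measure" and "\<epsilon> \<in> {1 / real n<..v}"
    then have \<epsilon>: "\<epsilon> > 0" using pos by auto
    show "1 * \<epsilon> powr 0 \<le> measure point_measure (graphon_ball point_measure zero_kernel x \<epsilon>)"
      unfolding graphon_ball_point[OF x \<epsilon>] prob_space.prob_space[OF prob_space_encoded_measure]
      using \<epsilon> by simp
  qed
  ultimately show "(point_measure, zero_kernel) \<in> W_min1 n D 1 m M v"
    and "(point_measure, zero_kernel) \<in> W_min2 n D 1 m M v"
    using assms pure_graphon_point has_minkowski_dim_point by (auto simp: W_min1_def W_min2_def dim)
qed

lemma emeasure_W_random_graph_point: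
  "1 \<le> emeasure (W_random_graph n point_measure zero_kernel) {\<lambda>i j. 0}"
proof -
  have "emeasure point_measure (space point_measure) ^ n
      \<le> emeasure (W_random_graph n point_measure zero_kernel) {\<lambda>i j. 0}"
    using pure_graphon_point
    by (intro power_le_emeasure_W_random_graph_zero) (auto simp: pure_graphon_def encoded_kernel_def)
  then show ?thesis
    using prob_space.emeasure_space_1[OF prob_space_encoded_measure, of "return_pmf ()"] by simp
qed

section \<open>The two-point lower bound\<close>

text \<open>The value of the estimator at \<open>A\<close> is at least \<open>D / 2\<close> away
  from one of the two dimensions; under that graphon \<open>A\<close> belongs to the error event and
  carries mass at least \<open>p\<close>.\<close>

lemma two_point_bound:
  fixes d_hat :: "adj_matrix \<Rightarrow> real"
  assumes mem: "(\<mu>0, W0) \<in> S" "(\<mu>1, W1) \<in> S"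
    and gr: "graphon \<mu>0 W0" "graphon \<mu>1 W1"
    and sep: "D \<le> \<bar>minkowski_dim \<mu>1 W1 - minkowski_dim \<mu>0 W0\<bar>"
    and atom: "p \<le> emeasure (W_random_graph n \<mu>0 W0) {A}" "p \<le> emeasure (W_random_graph n \<mu>1 W1) {A}"
  shows "p \<le> (SUP (\<mu>, W)\<in>S. emeasure (W_random_graph n \<mu> W)
    {A. \<bar>d_hat A - minkowski_dim \<mu> W\<bar> \<ge> D / 2})"
proof -
  have le: "p \<le> (SUP (\<mu>, W)\<in>S. emeasure (W_random_graph n \<mu> W)
      {A. \<bar>d_hat A - minkowski_dim \<mu> W\<bar> \<ge> D / 2})"
    if "(\<mu>, W) \<in> S" "graphon \<mu> W" "p \<le> emeasure (W_random_graph n \<mu> W) {A}"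
      "D / 2 \<le> \<bar>d_hat A - minkowski_dim \<mu> W\<bar>" for \<mu> W
  proof -
    have "p \<le> emeasure (W_random_graph n \<mu> W) {A}" by fact
    also have "\<dots> \<le> emeasure (W_random_graph n \<mu> W) {A. \<bar>d_hat A - minkowski_dim \<mu> W\<bar> \<ge> D / 2}"
      using that by (intro emeasure_mono) (auto simp: sets_W_random_graph)
    also have "\<dots> \<le> (SUP (\<mu>, W)\<in>S. emeasure (W_random_graph n \<mu> W)
        {A. \<bar>d_hat A - minkowski_dim \<mu> W\<bar> \<ge> D / 2})"
      using that(1) by (intro SUP_upper2) auto
    finally show ?thesis .
  qed
  have "D / 2 \<le> \<bar>d_hat A - minkowski_dim \<mu>0 W0\<bar> \<or> D / 2 \<le> \<bar>d_hat A - minkowski_dim \<mu>1 W1\<bar>"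
    using sep by linarith
  then show ?thesis
    using le mem gr atom by blast
qed

theorem theorem14:
  fixes D :: real
  assumes "D > 2"
  shows "\<exists>\<alpha> m M v :: real. \<alpha> > 0 \<and> 0 < m \<and> m \<le> 1 \<and> 1 \<le> M \<and> v > 0 \<and>
    (\<forall>\<W> \<in> {W_min1, W_min2}. \<forall>\<^sub>F n in sequentially.
       (INF d_hat :: adj_matrix \<Rightarrow> real.
          SUP (\<mu>, W) \<in> (\<W> n D \<alpha> m M v :: real graphon set).
            emeasure (W_random_graph n \<mu> W)
              {A. \<bar>d_hat A - minkowski_dim \<mu> W\<bar> \<ge> D / 2}) \<ge> ennreal (1 / 4))"
proof -
  define k where "k = walsh_graphon.\<kappa> D"
  define m where "m = (k / 16) powr D / 2"
  \<comment> \<open>The choice \<open>\<delta> = 1 / (2 * real n)\<close> makes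
    \<open>n * \<delta> = 1 / 2\<close>, and \<open>n \<ge> 1\<close> gives
    \<open>\<delta> \<le> 1 / 2\<close>.\<close>
  have graphon: "walsh_graphon D (1 / (2 * real n)) c" if "n \<ge> 1" "0 < c" "c \<le> 1" for n c
    using that assms by unfold_locales (auto simp: field_simps)
  have k_bounds: "0 < k" "k < 1"
    using walsh_graphon.\<kappa>[OF graphon[of 1 1]] by (auto simp: k_def)
  have m: "0 < m" "m \<le> 1"
    using k_bounds assms powr_le1[of D "k / 16"] by (auto simp: m_def)
  \<comment> \<open>The class \<open>S\<close> and the scaling \<open>c\<close> stay open, so that
    both cases share one argument.\<close>
  have bound: "ennreal (1 / 4) \<le> (INF d_hat :: adj_matrix \<Rightarrow> real. SUP (\<mu>, W) \<in> S.
      emeasure (W_random_graph n \<mu> W) {A. \<bar>d_hat A - minkowski_dim \<mu> W\<bar> \<ge> D / 2})"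
    if n: "n \<ge> 1" and c: "0 < c" "c \<le> 1"
      and S: "(point_measure, zero_kernel) \<in> S"
        "(encoded_measure (walsh_graphon.node_pmf D (1 / (2 * real n))),
          encoded_kernel (walsh_graphon.kernel c)) \<in> S" for n c and S :: "real graphon set"
  proof (rule INF_greatest)
    interpret walsh_graphon D "1 / (2 * real n)" c by (rule graphon[OF n c])
    fix d_hat :: "adj_matrix \<Rightarrow> real"
    show "ennreal (1 / 4) \<le> (SUP (\<mu>, W) \<in> S.
        emeasure (W_random_graph n \<mu> W) {A. \<bar>d_hat A - minkowski_dim \<mu> W\<bar> \<ge> D / 2})"
    proof (rule two_point_bound[OF S])
      show "graphon point_measure zero_kernel"
        using pure_graphon_point by (simp add: pure_graphon_def)
      show "D \<le> \<bar>minkowski_dim \<mu> W - minkowski_dim point_measure zero_kernel\<bar>"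
        by (simp add: minkowski_dim minkowski_dim_eqI[OF has_minkowski_dim_point])
      have quarter: "ennreal (1 / 4) \<le> ennreal 1" "ennreal (1 / 4) \<le> ennreal (1 / 2)"
        by (rule ennreal_leI; simp)+
      show "ennreal (1 / 4) \<le> emeasure (W_random_graph n point_measure zero_kernel) {\<lambda>i j. 0}"
        by (rule order_trans[OF quarter(1)]) (simp add: emeasure_W_random_graph_point)
      show "ennreal (1 / 4) \<le> emeasure (W_random_graph n \<mu> W) {\<lambda>i j. 0}"
        by (rule order_trans[OF quarter(2)], rule zero_adj_matrix_likely) (use n in simp)
    qed (rule local.graphon)
  qed
  show ?thesis
  proof (intro exI conjI ballI)
    fix \<W> :: "nat \<Rightarrow> real \<Rightarrow> real \<Rightarrow> real \<Rightarrow> real \<Rightarrow> real \<Rightarrow> real graphon set"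
    assume "\<W> \<in> {W_min1, W_min2}"
    then consider "\<W> = W_min1" | "\<W> = W_min2" by auto
    then show "\<forall>\<^sub>F n in sequentially. (INF d_hat :: adj_matrix \<Rightarrow> real.
        SUP (\<mu>, W) \<in> \<W> n D 1 m 4 (k / 32). emeasure (W_random_graph n \<mu> W)
          {A. \<bar>d_hat A - minkowski_dim \<mu> W\<bar> \<ge> D / 2}) \<ge> ennreal (1 / 4)"
    proof cases
      case 1
      show ?thesis
        using eventually_ge_at_top[of 1]
      proof eventually_elim
        case (elim n)
        \<comment> \<open>The unscaled kernel gives covering constants that do not depend on
          \<open>n\<close>.\<close>
        interpret walsh_graphon D "1 / (2 * real n)" 1 using elim by (intro graphon) auto
        show ?case
          unfolding 1
          using pure_graphon has_minkowski_dim minkowski_dim covering_condition[of n] m assms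
          by (intro bound[OF elim, of 1] point_in_classes) (auto simp: W_min1_def m_def k_def)
      qed
    next
      case 2
      show ?thesis
        using eventually_ge_at_top[of 1]
      proof eventually_elim
        case (elim n)
        \<comment> \<open>The scaling \<open>c = 1 / (2 * real n)\<close> puts the diameter below
          \<open>1 / real n\<close>.\<close>
        have scale: "0 < 1 / (2 * real n)" "1 / (2 * real n) \<le> 1" "1 / (2 * real n) < 1 / real n"
          using elim by (auto simp: field_simps)
        interpret walsh_graphon D "1 / (2 * real n)" "1 / (2 * real n)" using elim scale by (intro graphon) auto
        show ?case
          unfolding 2
          using pure_graphon has_minkowski_dim minkowski_dim mass_condition[OF scale(3)] m assms
          by (intro bound[OF elim scale(1,2)] point_in_classes) (auto simp: W_min2_def k_def)
      qed
    qed
  qed (use m k_bounds in auto)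
qed

end
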